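(* Let $r\ge 2$, and let $X$ and $Y$ be edge-subgraphs of $K_{r,r}$ such that $\delta(X)+\delta(Y)\ge 3r/2+1$. Then the friends-and-strangers graph $\mathsf{FS}(X,Y)$ has exactly two connected components.
   Context: $K_{r,r}$ is the complete bipartite graph with two parts of size $r$; an edge-subgraph of $K_{r,r}$ is a graph on the same $2r$ vertices whose edge set is a subset of that of $K_{r,r}$. For a simple graph $G$, $\delta(G)$ denotes its minimum degree. For two simple graphs $X$ and $Y$ with the same finite number of vertices, the friends-and-strangers graph $\mathsf{FS}(X,Y)$ has as vertex set all bijections $\sigma:V(X)\to V(Y)$; two bijections $\sigma,\tau$ are adjacent if and only if there are distinct vertices $a,b\in V(X)$ with $\{a,b\}\in E(X)$, $\{\sigma(a),\sigma(b)\}\in E(Y)$, $\tau(a)=\sigma(b)$, $\tau(b)=\sigma(a)$, and $\tau(w)=\sigma(w)$ for all $w\in V(X)\setminus\{a,b\}$. *)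

theory Defs
  imports
    "Graph_Theory.Graph_Theory"
    "HOL-Library.FuncSet"
begin

text \<open>
  A finite simple graph is a finite, loop-free, symmetric digraph (locale \<^locale>\<open>pair_graph\<close>), an
  undirected edge being a pair of opposite arcs. The degree of a vertex is therefore its out-degree.
\<close>

definition min_degree :: "('a, 'b) pre_digraph \<Rightarrow> nat" where
  "min_degree G = Min (out_degree G ` verts G)"

text \<open>
  Bijections are taken to be extensional (\<^const>\<open>undefined\<close> outside the vertex set of \<open>X\<close>), so that
  each bijection between the vertex sets is represented by exactly one function.
\<close>

definition friends_and_strangers ::
  "'a pair_pre_digraph \<Rightarrow> 'b pair_pre_digraph \<Rightarrow> ('a \<Rightarrow> 'b) pair_pre_digraph" where
  "friends_and_strangers X Y =
    (let V = {\<sigma> \<in> extensional (pverts X). bij_betw \<sigma> (pverts X) (pverts Y)} in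
      \<lparr> pverts = V,
        parcs = {(\<sigma>, \<tau>). \<sigma> \<in> V \<and> \<tau> \<in> V \<and>
          (\<exists>a \<in> pverts X. \<exists>b \<in> pverts X. a \<noteq> b \<and>
            (a, b) \<in> parcs X \<and> (\<sigma> a, \<sigma> b) \<in> parcs Y \<and>
            \<tau> a = \<sigma> b \<and> \<tau> b = \<sigma> a \<and> (\<forall>w \<in> pverts X - {a, b}. \<tau> w = \<sigma> w))} \<rparr>)"

lemma pair_graph_friends_and_strangers:
  assumes "pair_graph X" "pair_graph Y"
  shows "pair_graph (friends_and_strangers X Y)"
proof -
  interpret X: pair_graph X by fact
  interpret Y: pair_graph Y by fact
  let ?F = "friends_and_strangers X Y"
  let ?V = "{\<sigma> \<in> extensional (pverts X). bij_betw \<sigma> (pverts X) (pverts Y)}"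
  have V: "pverts ?F = ?V"
    by (simp add: friends_and_strangers_def Let_def)
  have E: "(\<sigma>, \<tau>) \<in> parcs ?F \<longleftrightarrow> \<sigma> \<in> ?V \<and> \<tau> \<in> ?V \<and>
          (\<exists>a \<in> pverts X. \<exists>b \<in> pverts X. a \<noteq> b \<and>
            (a, b) \<in> parcs X \<and> (\<sigma> a, \<sigma> b) \<in> parcs Y \<and>
            \<tau> a = \<sigma> b \<and> \<tau> b = \<sigma> a \<and> (\<forall>w \<in> pverts X - {a, b}. \<tau> w = \<sigma> w))" for \<sigma> \<tau>
    by (simp add: friends_and_strangers_def Let_def)
  have "?V \<subseteq> pverts X \<rightarrow>\<^sub>E pverts Y"
    by (auto simp: PiE_def bij_betw_def)
  then have fV: "finite (pverts ?F)"
    unfolding V by (rule finite_subset) (simp add: finite_PiE)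
  have sub: "parcs ?F \<subseteq> pverts ?F \<times> pverts ?F"
    using E V by auto
  have fE: "finite (parcs ?F)"
    by (rule finite_subset[OF sub]) (simp add: fV)
  have "sym (parcs Y)"
    using Y.pair_sym_arcs by (simp add: symmetric_def)
  then have sY: "(v, u) \<in> parcs Y" if "(u, v) \<in> parcs Y" for u v
    using that by (rule symD)
  have sF: "sym (parcs ?F)"
  proof (rule symI)
    fix \<sigma> \<tau>
    assume "(\<sigma>, \<tau>) \<in> parcs ?F"
    then obtain a b where ab: "\<sigma> \<in> ?V" "\<tau> \<in> ?V" "a \<in> pverts X" "b \<in> pverts X" "a \<noteq> b"
      "(a, b) \<in> parcs X" "(\<sigma> a, \<sigma> b) \<in> parcs Y" "\<tau> a = \<sigma> b" "\<tau> b = \<sigma> a"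
      "\<forall>w \<in> pverts X - {a, b}. \<tau> w = \<sigma> w"
      unfolding E by blast
    show "(\<tau>, \<sigma>) \<in> parcs ?F"
      unfolding E
      by (intro conjI bexI[of _ a] bexI[of _ b]) (use ab sY in auto)
  qed
  have nl: "\<sigma> \<noteq> \<tau>" if "(\<sigma>, \<tau>) \<in> parcs ?F" for \<sigma> \<tau>
  proof -
    from that obtain a b where "(\<sigma> a, \<sigma> b) \<in> parcs Y" "\<tau> a = \<sigma> b"
      unfolding E by blast
    then show ?thesis
      using Y.pair_no_loops by fastforce
  qed
  show ?thesis
    by unfold_locales (use sub fV fE sF nl in \<open>auto simp: symmetric_def\<close>)
qed

text \<open>
  Strong components are the connected components of a graph, because its arc relation is symmetric.
\<close>

abbreviation connected_components :: "('a, 'b) pre_digraph \<Rightarrow> ('a, 'b) pre_digraph set" where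
  "connected_components G \<equiv> pre_digraph.sccs G"

end

theory Submission
  imports Defs "HOL-Combinatorics.Permutations"
begin

text \<open>
  Let \<open>A\<close>, \<open>B\<close> be the sides of \<open>X\<close> and \<open>C\<close>, \<open>D\<close> those of \<open>Y\<close>. A pigeonhole and averaging argument shows
  that from every bijection one can reach a sorted one, with \<open>C\<close> standing on \<open>A\<close> and \<open>D\<close> on \<open>B\<close>; for
  this \<open>\<delta>(X) + \<delta>(Y) \<ge> 3r/2 + 1/2\<close> suffices, a bound that survives the removal of one vertex from each side.
  To exchange the people at \<open>a \<in> A\<close> and \<open>b \<in> B\<close> when only one of the two required edges is present,
  freeze them, sort everybody else, perform the exchange inside a copy of \<open>K\<^bsub>2,3\<^esub>\<close> with
  at most this one edge missing, and undo the sorting. Hence \<open>X\<close> and then \<open>Y\<close> may be replaced by complete bipartite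
  graphs, where the sign of the bijection combined with the parity of the number of people from \<open>C\<close>
  standing on \<open>A\<close> is the only invariant.
\<close>

section \<open>Counting\<close>

lemma card_Int_bound:
  assumes "finite U" "S \<subseteq> U" "T \<subseteq> U"
  shows "card S + card T \<le> card U + card (S \<inter> T)"
proof -
  have "finite S" "finite T" using assms finite_subset by auto
  then have "card S + card T = card (S \<union> T) + card (S \<inter> T)"
    by (rule card_Un_Int)
  moreover have "card (S \<union> T) \<le> card U" using assms by (intro card_mono) auto
  ultimately show ?thesis by linarith
qed

lemma card_Collect_Un:
  assumes "finite S" "finite T" "S \<inter> T = {}"
  shows "card {x \<in> S \<union> T. P x} = card {x \<in> S. P x} + card {x \<in> T. P x}"
proof -
  have "{x \<in> S \<union> T. P x} = {x \<in> S. P x} \<union> {x \<in> T. P x}" by auto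
  then show ?thesis using assms by (simp add: card_Un_disjoint disjoint_iff)
qed

lemma card_Collect_le: "finite S \<Longrightarrow> card {x \<in> S. P x} \<le> card S"
  by (rule card_mono) auto

text \<open>Each condition excludes only the complement of its set, so four large sets must meet. It
  supplies common neighbours under four adjacency constraints at once.\<close>

lemma card_Collect4_bound:
  assumes "finite U"
  shows "card {x \<in> U. P x} + card {x \<in> U. Q x} + card {x \<in> U. R x} + card {x \<in> U. S x}
    \<le> 3 * card U + card {x \<in> U. P x \<and> Q x \<and> R x \<and> S x}"
proof -
  let ?pq = "{x \<in> U. P x} \<inter> {x \<in> U. Q x}" and ?rs = "{x \<in> U. R x} \<inter> {x \<in> U. S x}"
  have "card {x \<in> U. P x} + card {x \<in> U. Q x} \<le> card U + card ?pq"
    "card {x \<in> U. R x} + card {x \<in> U. S x} \<le> card U + card ?rs"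
    "card ?pq + card ?rs \<le> card U + card (?pq \<inter> ?rs)"
    using assms by (intro card_Int_bound; auto)+
  moreover have "?pq \<inter> ?rs = {x \<in> U. P x \<and> Q x \<and> R x \<and> S x}" by auto
  ultimately show ?thesis by simp
qed

text \<open>Sum the left-hand side over all pairs \<open>(a, w)\<close>.\<close>

lemma exists_pair_small_degree_sum:
  fixes E H :: "'a \<Rightarrow> 'a \<Rightarrow> bool"
  assumes "finite S" "finite T" "card S = m" "card T = m" "S \<noteq> {}"
    and disj: "\<And>a b. a \<in> S \<Longrightarrow> b \<in> T \<Longrightarrow> \<not> (E a b \<and> H a b)"
  shows "\<exists>a \<in> S. \<exists>w \<in> T. card {b \<in> T. E a b} + card {x \<in> S. H x w} \<le> m"
proof (rule ccontr)
  assume "\<not> ?thesis"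
  then have big: "m + 1 \<le> card {b \<in> T. E a b} + card {x \<in> S. H x w}" if "a \<in> S" "w \<in> T" for a w
    using that by force
  have m: "m > 0" using assms by (metis card_gt_0_iff)
  \<comment> \<open>Double counting: the \<open>E\<close>-pairs are recounted by columns
    \<open>w\<close>, where they can be compared with the \<open>H\<close>-pairs.\<close>
  have "(\<Sum>a\<in>S. card {b \<in> T. E a b}) + (\<Sum>w\<in>T. card {x \<in> S. H x w})
      = (\<Sum>w\<in>T. card {x \<in> S. E x w}) + (\<Sum>w\<in>T. card {x \<in> S. H x w})"
    using sum_multicount_gen[of S T "\<lambda>a b. E a b" "\<lambda>b. card {x \<in> S. E x b}"] assms by simp
  also have "\<dots> = (\<Sum>w\<in>T. card {x \<in> S. E x w} + card {x \<in> S. H x w})"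
    by (simp add: sum.distrib)
  also have "\<dots> \<le> (\<Sum>w\<in>T. m)"
  proof (rule sum_mono)
    fix w assume w: "w \<in> T"
    \<comment> \<open>By \<open>disj\<close> the two neighbourhoods of \<open>w\<close> are disjoint
      subsets of \<open>S\<close>.\<close>
    have "card {x \<in> S. E x w} + card {x \<in> S. H x w} = card ({x \<in> S. E x w} \<union> {x \<in> S. H x w})"
      using assms(1) disj w by (subst card_Un_disjoint) auto
    also have "\<dots> \<le> card S" using assms(1) by (intro card_mono) auto
    finally show "card {x \<in> S. E x w} + card {x \<in> S. H x w} \<le> m" using assms by simp
  qed
  finally have up: "(\<Sum>a\<in>S. card {b \<in> T. E a b}) + (\<Sum>w\<in>T. card {x \<in> S. H x w}) \<le> m * m"
    using assms by simp
  \<comment> \<open>Over all pairs, every row count and every column count occurs \<open>m\<close>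
    times, hence the factor \<open>m\<close> below.\<close>
  have "(\<Sum>a\<in>S. \<Sum>w\<in>T. m + 1) \<le> (\<Sum>a\<in>S. \<Sum>w\<in>T. card {b \<in> T. E a b} + card {x \<in> S. H x w})"
    using big by (intro sum_mono) auto
  also have "\<dots> = m * ((\<Sum>a\<in>S. card {b \<in> T. E a b}) + (\<Sum>w\<in>T. card {x \<in> S. H x w}))"
    using assms by (simp add: sum.distrib sum_distrib_left distrib_left)
  also have "\<dots> \<le> m * (m * m)" using up by simp
  finally have "m * (m * (m + 1)) \<le> m * (m * m)" using assms by simp
  then show False using m by simp
qed

text \<open>
  Here \<open>A1 \<union> A2\<close> and \<open>B1 \<union> B2\<close> are the two sides of \<open>X\<close>; the people standing on \<open>A1 \<union> B2\<close> form
  one side of \<open>Y\<close> and those on \<open>A2 \<union> B1\<close> the other, and \<open>H\<close> is the adjacency of \<open>Y\<close> pulled back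
  to positions. The two alternatives are the swap, or the three swaps, that shrink \<open>A2\<close>.
\<close>

lemma reducing_configuration:
  fixes E H :: "'a \<Rightarrow> 'a \<Rightarrow> bool" and d e k m :: nat
  assumes fin: "finite A1" "finite A2" "finite B1" "finite B2"
    and disj: "A1 \<inter> A2 = {}" "B1 \<inter> B2 = {}" "(A1 \<union> A2) \<inter> (B1 \<union> B2) = {}"
    and card: "card A2 = m" "card B2 = m" "card A1 = k" "card B1 = k" "m > 0"
    and symH: "\<And>x y. H x y \<Longrightarrow> H y x"
    and EA: "\<And>a. a \<in> A1 \<union> A2 \<Longrightarrow> d \<le> card {b \<in> B1 \<union> B2. E a b}"
    and EB: "\<And>b. b \<in> B1 \<union> B2 \<Longrightarrow> d \<le> card {a \<in> A1 \<union> A2. E a b}"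
    and HC: "\<And>x. x \<in> A1 \<union> B2 \<Longrightarrow> e \<le> card {y \<in> A2 \<union> B1. H x y}"
    and HD: "\<And>y. y \<in> A2 \<union> B1 \<Longrightarrow> e \<le> card {x \<in> A1 \<union> B2. H y x}"
    and deg: "2 * (d + e) \<ge> 3 * (k + m) + 1"
  shows "(\<exists>a \<in> A2. \<exists>b \<in> B2. E a b \<and> H a b) \<or>
    (\<exists>a \<in> A2. \<exists>w \<in> B2. \<exists>a' \<in> A1. \<exists>b' \<in> B1.
      E a' b' \<and> H a' b' \<and> E a' w \<and> H b' w \<and> E a b' \<and> H a a')"
proof (rule disjCI)
  assume "\<not> (\<exists>a \<in> A2. \<exists>w \<in> B2. \<exists>a' \<in> A1. \<exists>b' \<in> B1.
      E a' b' \<and> H a' b' \<and> E a' w \<and> H b' w \<and> E a b' \<and> H a a')"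
  then have no3: "\<not> (E a' b' \<and> H a' b' \<and> E a' w \<and> H b' w \<and> E a b' \<and> H a a')"
    if "a \<in> A2" "w \<in> B2" "a' \<in> A1" "b' \<in> B1" for a w a' b'
    using that by blast
  show "\<exists>a \<in> A2. \<exists>b \<in> B2. E a b \<and> H a b"
  proof (rule ccontr)
    assume "\<not> ?thesis"
    then have no1: "\<not> (E a b \<and> H a b)" if "a \<in> A2" "b \<in> B2" for a b
      using that by blast
    have ne: "A2 \<noteq> {}" using card by auto
    have EA': "d \<le> card {b \<in> B1. E a b} + card {b \<in> B2. E a b}" if "a \<in> A1 \<union> A2" for a
      using EA[OF that] fin disj by (subst (asm) card_Collect_Un) auto
    have EB': "d \<le> card {a \<in> A1. E a b} + card {a \<in> A2. E a b}" if "b \<in> B1 \<union> B2" for b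
      using EB[OF that] fin disj by (subst (asm) card_Collect_Un) auto
    have HC': "e \<le> card {y \<in> A2. H x y} + card {y \<in> B1. H x y}" if "x \<in> A1 \<union> B2" for x
      using HC[OF that] fin disj by (subst (asm) card_Collect_Un) auto
    have HD': "e \<le> card {x \<in> A1. H y x} + card {x \<in> B2. H y x}" if "y \<in> A2 \<union> B1" for y
      using HD[OF that] fin disj by (subst (asm) card_Collect_Un) auto
    have le: "card {y \<in> A2. P y} \<le> m" "card {y \<in> B2. P y} \<le> m"
        "card {y \<in> A1. P y} \<le> k" "card {y \<in> B1. P y} \<le> k" for P
      using fin[THEN card_Collect_le, of P] card by simp_all
    \<comment> \<open>That is, \<open>m < k\<close>. For \<open>a \<in> A2\<close> the
      \<open>E\<close>- and \<open>H\<close>-neighbours in \<open>B2\<close> are disjoint, so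
      \<open>d + e \<le> 2 * k + m\<close>; compare with \<open>deg\<close>.\<close>
    have km: "2 * m + 1 \<le> k + m"
    proof -
      obtain a where a: "a \<in> A2" using ne by blast
      have "card {b \<in> B2. E a b} + card {b \<in> B2. H a b}
          = card ({b \<in> B2. E a b} \<union> {b \<in> B2. H a b})"
        using fin no1 a by (subst card_Un_disjoint) auto
      also have "\<dots> \<le> card B2" using fin by (intro card_mono) auto
      finally have "card {b \<in> B2. E a b} + card {b \<in> B2. H a b} \<le> m" using card by simp
      then show ?thesis using EA'[of a] HD'[of a] a deg le(3)[of "H a"] le(4)[of "E a"] by simp
    qed
    \<comment> \<open>\<open>E\<close>-neighbours of \<open>a\<close> in \<open>B2\<close> and
      \<open>H\<close>-neighbours of \<open>w\<close> in \<open>A2\<close> are lost for the choice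
      of \<open>b'\<close> in \<open>B1\<close>. Averaging bounds the joint loss by \<open>m\<close>
      instead of the trivial \<open>2 * m\<close>.\<close>
    obtain a w where aw: "a \<in> A2" "w \<in> B2"
      and small: "card {b \<in> B2. E a b} + card {x \<in> A2. H x w} \<le> m"
      using exists_pair_small_degree_sum[of A2 B2 m E H] fin card ne no1 by blast
    have Hw: "{x \<in> A2. H x w} = {x \<in> A2. H w x}" using symH by blast
    \<comment> \<open>Used with \<open>x\<close> and \<open>y\<close> the numbers of positions in
      \<open>A1\<close> suitable for \<open>w\<close> and for \<open>a\<close>: since
      \<open>m < k\<close>, the two sets overlap, which yields \<open>a'\<close>.\<close>
    have pos: "0 < c" if "x + y \<le> card A1 + c" "d \<le> x + m" "e \<le> y + m" for x y c :: nat
      using that deg km card(3) by simp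
    have "card {x \<in> A1. E x w} + card {x \<in> A1. H a x} \<le> card A1 + card ({x \<in> A1. E x w} \<inter> {x \<in> A1. H a x})"
      using fin by (intro card_Int_bound) auto
    moreover have "card {x \<in> A1. E x w} + m \<ge> d" "card {x \<in> A1. H a x} + m \<ge> e"
      using EB'[of w] HD'[of a] aw le(1)[of "\<lambda>x. E x w"] le(2)[of "H a"] by simp_all
    ultimately have "card ({x \<in> A1. E x w} \<inter> {x \<in> A1. H a x}) > 0"
      by (rule pos)
    then obtain a' where a': "a' \<in> A1" "E a' w" "H a a'"
      unfolding card_gt_0_iff by blast
    \<comment> \<open>The conditions from \<open>a\<close> and \<open>w\<close> together lose at
      most \<open>m\<close>, each of the two from \<open>a'\<close> at most \<open>m\<close>. So the
      four counts add up to at least \<open>2 * (d + e) - 3 * m > 3 * k\<close>.\<close>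
    have "card {b \<in> B1. E a b} + card {b \<in> B1. E a' b} + card {b \<in> B1. H w b} + card {b \<in> B1. H a' b}
        \<le> 3 * card B1 + card {b \<in> B1. E a b \<and> E a' b \<and> H w b \<and> H a' b}"
      using fin by (intro card_Collect4_bound)
    moreover have "d \<le> card {b \<in> B1. E a b} + card {b \<in> B2. E a b}" "d \<le> card {b \<in> B1. E a' b} + m"
      "e \<le> card {b \<in> B1. H w b} + card {x \<in> A2. H x w}" "e \<le> card {b \<in> B1. H a' b} + m"
      using EA'[of a] EA'[of a'] HC'[of w] HC'[of a'] aw a' Hw le(2)[of "E a'"] le(1)[of "H a'"]
      by simp_all
    ultimately have "card {b \<in> B1. E a b \<and> E a' b \<and> H w b \<and> H a' b} > 0"
      using deg small card by simp
    then obtain b' where "b' \<in> B1" "E a b'" "E a' b'" "H w b'" "H a' b'"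
      unfolding card_gt_0_iff by blast
    then show False using no3[OF aw a'(1)] a' symH by blast
  qed
qed

section \<open>Sequences of swaps\<close>

text \<open>Edges of \<open>X\<close> are read in one direction, from \<open>A\<close> to
  \<open>B\<close>. Writing the result as a composition with \<open>transpose\<close> lets sequences
  of swaps be handled algebraically.\<close>

definition swap_step ::
  "'a set \<Rightarrow> 'a set \<Rightarrow> ('a \<Rightarrow> 'a \<Rightarrow> bool) \<Rightarrow> ('b \<Rightarrow> 'b \<Rightarrow> bool) \<Rightarrow> ('a \<Rightarrow> 'b) \<Rightarrow> ('a \<Rightarrow> 'b) \<Rightarrow> bool"
  where "swap_step A B E F \<sigma> \<tau> \<longleftrightarrow>
    (\<exists>a \<in> A. \<exists>b \<in> B. E a b \<and> F (\<sigma> a) (\<sigma> b) \<and> \<tau> = \<sigma> \<circ> transpose a b)"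

abbreviation swap_reach ::
  "'a set \<Rightarrow> 'a set \<Rightarrow> ('a \<Rightarrow> 'a \<Rightarrow> bool) \<Rightarrow> ('b \<Rightarrow> 'b \<Rightarrow> bool) \<Rightarrow> ('a \<Rightarrow> 'b) \<Rightarrow> ('a \<Rightarrow> 'b) \<Rightarrow> bool"
  where "swap_reach A B E F \<equiv> (swap_step A B E F)\<^sup>*\<^sup>*"

lemma swap_stepI:
  assumes "a \<in> A" "b \<in> B" "E a b" "F (\<sigma> a) (\<sigma> b)" "\<tau> = \<sigma> \<circ> transpose a b"
  shows "swap_step A B E F \<sigma> \<tau>"
  using assms unfolding swap_step_def by blast

text \<open>Makes explicit move sequences checkable by simplification: each pair is tested against
  the bijection reached by the preceding swaps.\<close>

fun legal_path ::
  "'a set \<Rightarrow> 'a set \<Rightarrow> ('a \<Rightarrow> 'a \<Rightarrow> bool) \<Rightarrow> ('b \<Rightarrow> 'b \<Rightarrow> bool) \<Rightarrow> ('a \<times> 'a) list \<Rightarrow> ('a \<Rightarrow> 'b) \<Rightarrow> bool"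
  where
    "legal_path A B E F [] \<sigma> \<longleftrightarrow> True"
  | "legal_path A B E F ((a, b) # ps) \<sigma> \<longleftrightarrow>
      a \<in> A \<and> b \<in> B \<and> E a b \<and> F (\<sigma> a) (\<sigma> b) \<and> legal_path A B E F ps (\<sigma> \<circ> transpose a b)"

lemma swap_reach_path:
  "legal_path A B E F ps \<sigma> \<Longrightarrow> swap_reach A B E F \<sigma> (foldl (\<lambda>\<tau> (a, b). \<tau> \<circ> transpose a b) \<sigma> ps)"
proof (induction A B E F ps \<sigma> rule: legal_path.induct)
  case (2 A B E F a b ps \<sigma>)
  then have "swap_step A B E F \<sigma> (\<sigma> \<circ> transpose a b)" by (auto intro: swap_stepI)
  moreover have "legal_path A B E F ps (\<sigma> \<circ> transpose a b)" using 2 by simp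
  ultimately have "swap_reach A B E F \<sigma> (foldl (\<lambda>\<tau> (a, b). \<tau> \<circ> transpose a b) (\<sigma> \<circ> transpose a b) ps)"
    using 2 by (blast intro: converse_rtranclp_into_rtranclp)
  then show ?case by (simp only: foldl.simps prod.case)
qed simp

lemma swap_reach_single:
  assumes "a \<in> A" "b \<in> B" "E a b" "F (\<sigma> a) (\<sigma> b)"
  shows "swap_reach A B E F \<sigma> (\<sigma> \<circ> transpose a b)"
  using swap_reach_path[of A B E F "[(a, b)]" \<sigma>] assms by simp

text \<open>Every swap undoes itself; \<open>symF\<close> enters because the two people have traded
  places.\<close>

lemma swap_reach_sym:
  assumes symF: "\<And>p q. F p q \<Longrightarrow> F q p" and "swap_reach A B E F \<sigma> \<tau>"
  shows "swap_reach A B E F \<tau> \<sigma>"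
  using assms(2)
proof (induction rule: rtranclp_induct)
  case (step \<rho> \<tau>)
  then obtain a b where ab: "a \<in> A" "b \<in> B" "E a b" "F (\<rho> a) (\<rho> b)" "\<tau> = \<rho> \<circ> transpose a b"
    by (auto simp: swap_step_def)
  then have "\<rho> = \<tau> \<circ> transpose a b" by (simp add: comp_assoc)
  moreover have "F (\<tau> a) (\<tau> b)" using ab symF by simp
  ultimately have "swap_step A B E F \<tau> \<rho>" using ab(1-3) by (blast intro: swap_stepI)
  then show ?case using step.IH by (rule converse_rtranclp_into_rtranclp)
qed simp

lemma swap_reach_mono:
  assumes "A \<subseteq> A'" "B \<subseteq> B'" "swap_reach A B E F \<sigma> \<tau>"
  shows "swap_reach A' B' E F \<sigma> \<tau>"
proof -
  have "swap_step A B E F \<le> swap_step A' B' E F"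
    using assms(1,2) unfolding swap_step_def by blast
  then show ?thesis using assms(3) by (blast dest: rtranclp_mono)
qed

lemma bij_betw_comp_transpose:
  assumes "bij_betw \<sigma> S T" "a \<in> S" "b \<in> S"
  shows "bij_betw (\<sigma> \<circ> transpose a b) S T"
proof (rule bij_betw_trans[OF _ assms(1)])
  show "bij_betw (transpose a b) S S"
    using permutes_swap_id[OF assms(2,3)] by (rule permutes_imp_bij)
qed

lemma swap_reach_bij_betw:
  assumes "swap_reach A B E F \<sigma> \<tau>" "bij_betw \<sigma> S T" "A \<union> B \<subseteq> S"
  shows "bij_betw \<tau> S T"
  using assms(1,2)
  by (induction rule: rtranclp_induct)
    (use assms(3) in \<open>auto simp: swap_step_def intro!: bij_betw_comp_transpose\<close>)

lemma swap_reach_outside: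
  assumes "swap_reach A B E F \<sigma> \<tau>" "x \<notin> A \<union> B"
  shows "\<tau> x = \<sigma> x"
  using assms(1)
proof (induction rule: rtranclp_induct)
  case (step \<rho> \<tau>)
  then obtain a b where "a \<in> A" "b \<in> B" "\<tau> = \<rho> \<circ> transpose a b"
    by (auto simp: swap_step_def)
  then show ?case using step.IH assms(2) by (auto simp: transpose_def)
qed simp

text \<open>Legality of a swap away from \<open>a\<close> and \<open>b\<close> does not depend on
  who stands there, and disjoint transpositions commute. A path can thus be replayed after a frozen
  pair has been exchanged.\<close>

lemma swap_reach_comp_transpose:
  assumes "swap_reach A B E F \<sigma> \<tau>" "a \<notin> A \<union> B" "b \<notin> A \<union> B"
  shows "swap_reach A B E F (\<sigma> \<circ> transpose a b) (\<tau> \<circ> transpose a b)"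
  using assms(1)
proof (induction rule: rtranclp_induct)
  case (step \<rho> \<tau>)
  then obtain x y where xy: "x \<in> A" "y \<in> B" "E x y" "F (\<rho> x) (\<rho> y)" "\<tau> = \<rho> \<circ> transpose x y"
    by (auto simp: swap_step_def)
  then have ne: "x \<noteq> a" "x \<noteq> b" "y \<noteq> a" "y \<noteq> b" using assms(2,3) by auto
  then have "transpose x y \<circ> transpose a b = transpose a b \<circ> transpose x y"
    by (auto simp: fun_eq_iff transpose_def)
  then have "\<tau> \<circ> transpose a b = (\<rho> \<circ> transpose a b) \<circ> transpose x y"
    using xy(5) by (simp add: comp_assoc)
  then have "swap_step A B E F (\<rho> \<circ> transpose a b) (\<tau> \<circ> transpose a b)"
    using xy ne by (intro swap_stepI[of x _ y]) simp_all
  then show ?case using step.IH by (rule rtranclp.rtrancl_into_rtrancl[rotated])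
qed simp

section \<open>Sorting a bijection under degree conditions\<close>

lemma card_Collect_pullback:
  assumes "inj_on \<sigma> S" "\<sigma> ` S = T"
  shows "card {x \<in> S. P (\<sigma> x)} = card {y \<in> T. P y}"
proof -
  have "card (\<sigma> ` {x \<in> S. P (\<sigma> x)}) = card {x \<in> S. P (\<sigma> x)}"
    using assms(1) by (intro card_image) (auto intro: inj_on_subset)
  moreover have "\<sigma> ` {x \<in> S. P (\<sigma> x)} = {y \<in> T. P y}" using assms(2) by auto
  ultimately show ?thesis by simp
qed

lemma sorted_if_image_subset:
  assumes "finite C" "card A = card C" "A \<inter> B = {}" "C \<inter> D = {}"
    and "bij_betw \<sigma> (A \<union> B) (C \<union> D)" "\<sigma> ` A \<subseteq> C"
  shows "\<sigma> ` A = C \<and> \<sigma> ` B = D"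
proof -
  have inj: "inj_on \<sigma> (A \<union> B)" and im: "\<sigma> ` (A \<union> B) = C \<union> D"
    using assms(5) by (auto simp: bij_betw_def)
  have "card (\<sigma> ` A) = card A"
    using inj by (intro card_image) (auto intro: inj_on_subset)
  then have A: "\<sigma> ` A = C" using assms by (intro card_subset_eq) auto
  have "\<sigma> ` A \<inter> \<sigma> ` B = {}"
    using inj assms(3) by (auto simp: inj_on_def disjoint_iff)
  moreover have "\<sigma> ` A \<union> \<sigma> ` B = C \<union> D" using im by (simp add: image_Un)
  ultimately have "\<sigma> ` B = D" using A assms(4) by blast
  with A show ?thesis by blast
qed

text \<open>\<open>d\<close> and \<open>e\<close> are mere lower bounds on degrees, so the
  assumptions pass to smaller vertex sets with \<open>d - 1\<close>, \<open>e - 1\<close>, and to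
  \<open>E\<close> replaced by the complete relation. The bound on \<open>d + e\<close> is left out
  because sorting and exchanging use different ones.\<close>

locale bipartite_degrees =
  fixes A B :: "'a set" and C D :: "'b set"
    and E :: "'a \<Rightarrow> 'a \<Rightarrow> bool" and F :: "'b \<Rightarrow> 'b \<Rightarrow> bool" and r d e :: nat
  assumes fin: "finite A" "finite B" "finite C" "finite D"
    and disj: "A \<inter> B = {}" "C \<inter> D = {}"
    and card: "card A = r" "card B = r" "card C = r" "card D = r"
    and symF: "\<And>p q. F p q \<Longrightarrow> F q p"
    and EA: "\<And>a. a \<in> A \<Longrightarrow> d \<le> card {b \<in> B. E a b}"
    and EB: "\<And>b. b \<in> B \<Longrightarrow> d \<le> card {a \<in> A. E a b}"
    and FC: "\<And>p. p \<in> C \<Longrightarrow> e \<le> card {q \<in> D. F p q}"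
    and FD: "\<And>q. q \<in> D \<Longrightarrow> e \<le> card {p \<in> C. F q p}"
begin

text \<open>The measure is the number of people from \<open>D\<close> standing on \<open>A\<close>;
  \<open>reducing_configuration\<close> lowers it by one.\<close>

lemma swap_reach_sorted:
  assumes deg: "3 * r + 1 \<le> 2 * (d + e)" and bij: "bij_betw \<sigma> (A \<union> B) (C \<union> D)"
  shows "\<exists>\<tau>. swap_reach A B E F \<sigma> \<tau> \<and> \<tau> ` A = C \<and> \<tau> ` B = D"
  using bij
proof (induction "card {a \<in> A. \<sigma> a \<in> D}" arbitrary: \<sigma> rule: less_induct)
  case less
  let ?A1 = "{a \<in> A. \<sigma> a \<in> C}" and ?A2 = "{a \<in> A. \<sigma> a \<in> D}"
  let ?B1 = "{b \<in> B. \<sigma> b \<in> D}" and ?B2 = "{b \<in> B. \<sigma> b \<in> C}"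
  have inj: "inj_on \<sigma> (A \<union> B)" and im: "\<sigma> ` (A \<union> B) = C \<union> D"
    using less.prems by (auto simp: bij_betw_def)
  have mem: "\<sigma> x \<in> C \<or> \<sigma> x \<in> D" if "x \<in> A \<union> B" for x using im that by blast
  show ?case
  proof (cases "?A2 = {}")
    case True
    then have "\<sigma> ` A \<subseteq> C" using mem by blast
    then show ?thesis
      using sorted_if_image_subset[of C A B D \<sigma>] fin card disj less.prems by auto
  next
    case False
    have A: "?A1 \<union> ?A2 = A" "?A1 \<inter> ?A2 = {}" and B: "?B1 \<union> ?B2 = B" "?B1 \<inter> ?B2 = {}"
      using mem disj by auto
    have onto: "\<exists>x \<in> A \<union> B. y = \<sigma> x" if "y \<in> C \<union> D" for y
      using that unfolding im[symmetric] by blast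
    have imC: "\<sigma> ` (?A1 \<union> ?B2) = C"
    proof (intro equalityI subsetI)
      show "y \<in> \<sigma> ` (?A1 \<union> ?B2)" if "y \<in> C" for y using onto[of y] that by blast
    qed auto
    have imD: "\<sigma> ` (?A2 \<union> ?B1) = D"
    proof (intro equalityI subsetI)
      show "y \<in> \<sigma> ` (?A2 \<union> ?B1)" if "y \<in> D" for y using onto[of y] that by blast
    qed auto
    have injC: "inj_on \<sigma> (?A1 \<union> ?B2)" and injD: "inj_on \<sigma> (?A2 \<union> ?B1)"
      using inj by (auto intro: inj_on_subset)
    have fin': "finite ?A1" "finite ?A2" "finite ?B1" "finite ?B2" using fin by auto
    have cA: "card ?A1 + card ?A2 = r"
      using card_Un_disjoint[OF fin'(1,2) A(2)] A(1) card by simp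
    have cB: "card ?B1 + card ?B2 = r"
      using card_Un_disjoint[OF fin'(3,4) B(2)] B(1) card by simp
    \<comment> \<open>The people of \<open>C\<close> occupy \<open>?A1 \<union> ?B2\<close>, so
      \<open>?B2\<close> has the same size as \<open>?A2\<close>: misplaced people are equally many
      on both sides.\<close>
    have "card ?A1 + card ?B2 = card (?A1 \<union> ?B2)"
      using fin' disj by (subst card_Un_disjoint) auto
    then have cC: "card ?A1 + card ?B2 = r"
      using card_image[OF injC] imC card by simp
    have pos: "card ?A2 > 0" using False fin' by (simp add: card_gt_0_iff)
    let ?H = "\<lambda>x y. F (\<sigma> x) (\<sigma> y)"
    have "(\<exists>a \<in> ?A2. \<exists>b \<in> ?B2. E a b \<and> ?H a b) \<or>
      (\<exists>a \<in> ?A2. \<exists>w \<in> ?B2. \<exists>a' \<in> ?A1. \<exists>b' \<in> ?B1.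
        E a' b' \<and> ?H a' b' \<and> E a' w \<and> ?H b' w \<and> E a b' \<and> ?H a a')"
    proof (rule reducing_configuration[where m = "card ?A2" and k = "card ?A1" and d = d and e = e])
      show "e \<le> card {y \<in> ?A2 \<union> ?B1. ?H x y}" if "x \<in> ?A1 \<union> ?B2" for x
        unfolding card_Collect_pullback[OF injD imD] using FC that by auto
      show "e \<le> card {y \<in> ?A1 \<union> ?B2. ?H x y}" if "x \<in> ?A2 \<union> ?B1" for x
        unfolding card_Collect_pullback[OF injC imC] using FD that by auto
      show "d \<le> card {b \<in> ?B1 \<union> ?B2. E a b}" if "a \<in> ?A1 \<union> ?A2" for a
        using EA that unfolding A B by blast
      show "d \<le> card {a \<in> ?A1 \<union> ?A2. E a b}" if "b \<in> ?B1 \<union> ?B2" for b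
        using EB that unfolding A B by blast
      show "3 * (card ?A1 + card ?A2) + 1 \<le> 2 * (d + e)" using deg cA by simp
    qed (use fin' A B cA cB cC pos disj symF in auto)
    then obtain a \<tau> where a: "a \<in> ?A2" and reach: "swap_reach A B E F \<sigma> \<tau>"
      and dec: "{x \<in> A. \<tau> x \<in> D} = ?A2 - {a}"
    proof (elim disjE bexE conjE)
      fix a b assume ab: "a \<in> ?A2" "b \<in> ?B2" "E a b" "?H a b"
      have "{x \<in> A. (\<sigma> \<circ> transpose a b) x \<in> D} = ?A2 - {a}"
        using ab disj by (auto simp: transpose_def)
      moreover have "swap_reach A B E F \<sigma> (\<sigma> \<circ> transpose a b)"
        using ab by (intro swap_reach_single) auto
      ultimately show thesis using that ab(1) by blast
    next
      fix a w a' b'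
      assume h: "a \<in> ?A2" "w \<in> ?B2" "a' \<in> ?A1" "b' \<in> ?B1"
        "E a' b'" "?H a' b'" "E a' w" "?H b' w" "E a b'" "?H a a'"
      have ne: "a \<noteq> a'" "w \<noteq> b'" "a \<noteq> w" "a \<noteq> b'" "a' \<noteq> w" "a' \<noteq> b'"
        using h disj by auto
      \<comment> \<open>Net effect: the person at \<open>a'\<close> moves to \<open>a\<close>,
        \<open>w\<close> to \<open>a'\<close>, \<open>b'\<close> to \<open>w\<close>, and
        \<open>a\<close> to \<open>b'\<close>. Afterwards \<open>a\<close> and \<open>a'\<close>
        both carry people from \<open>C\<close>.\<close>
      let ?ps = "[(a', b'), (a', w), (a, b')]"
      let ?\<tau> = "\<sigma> \<circ> transpose a' b' \<circ> transpose a' w \<circ> transpose a b'"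
      have "legal_path A B E F ?ps \<sigma>"
        using h ne ne[symmetric] by (simp add: transpose_def)
      from swap_reach_path[OF this] have reach': "swap_reach A B E F \<sigma> ?\<tau>" by simp
      have "?\<tau> a = \<sigma> a'" "?\<tau> a' = \<sigma> w"
        using ne by (auto simp: transpose_def)
      moreover have "?\<tau> x = \<sigma> x" if "x \<in> A" "x \<noteq> a" "x \<noteq> a'" for x
        using that h disj by (auto simp: transpose_def)
      ultimately have "x \<in> A \<Longrightarrow> ?\<tau> x \<in> D \<longleftrightarrow> \<sigma> x \<in> D \<and> x \<noteq> a" for x
        using h disj by (cases "x = a"; cases "x = a'") auto
      then have "{x \<in> A. ?\<tau> x \<in> D} = ?A2 - {a}" by blast
      with reach' show thesis using that h(1) by blast
    qed
    have "card {x \<in> A. \<tau> x \<in> D} < card ?A2"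
      unfolding dec using a fin' by (intro card_Diff1_less) auto
    moreover have "bij_betw \<tau> (A \<union> B) (C \<union> D)"
      using swap_reach_bij_betw[OF reach less.prems] by simp
    ultimately obtain \<tau>' where "swap_reach A B E F \<tau> \<tau>'" "\<tau>' ` A = C" "\<tau>' ` B = D"
      using less.hyps by blast
    then show ?thesis using reach rtranclp_trans by metis
  qed
qed

end

section \<open>Exchanging two people across a missing edge\<close>

text \<open>
  All edges between \<open>{a, a'}\<close> and \<open>{b, b1, b2}\<close> and between the people standing there are present,
  except that one of the two edges used by the swap at \<open>a\<close>, \<open>b\<close> may be missing. The two move
  sequences were found by exhaustive search on these five positions.
\<close>

lemma swap_reach_local_exchange:
  assumes mem: "a \<in> A" "a' \<in> A" "b \<in> B" "b1 \<in> B" "b2 \<in> B"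
    and disj: "A \<inter> B = {}" and ne: "a \<noteq> a'" "b \<noteq> b1" "b \<noteq> b2" "b1 \<noteq> b2"
    and symF: "\<And>p q. F p q \<Longrightarrow> F q p"
    and E: "E a b1" "E a b2" "E a' b" "E a' b1" "E a' b2"
    and F: "F (\<sigma> a) (\<sigma> b1)" "F (\<sigma> a) (\<sigma> b2)"
      "F (\<sigma> a') (\<sigma> b)" "F (\<sigma> a') (\<sigma> b1)" "F (\<sigma> a') (\<sigma> b2)"
    and EF: "E a b \<or> F (\<sigma> a) (\<sigma> b)"
  shows "swap_reach A B E F \<sigma> (\<sigma> \<circ> transpose a b)"
proof -
  have ne': "a \<noteq> b" "a \<noteq> b1" "a \<noteq> b2" "a' \<noteq> b" "a' \<noteq> b1" "a' \<noteq> b2"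
    using mem disj by auto
  note neq = ne ne' ne[symmetric] ne'[symmetric]
  note F' = F F[THEN symF]
  have cases: "x = a \<or> x = a' \<or> x = b \<or> x = b1 \<or> x = b2 \<or>
    (x \<noteq> a \<and> x \<noteq> a' \<and> x \<noteq> b \<and> x \<noteq> b1 \<and> x \<noteq> b2)" for x
    by blast
  from EF show ?thesis
  proof
    assume F0: "F (\<sigma> a) (\<sigma> b)"
    \<comment> \<open>No swap uses the positions \<open>a\<close>, \<open>b\<close>, so
      \<open>E a b\<close> may fail.\<close>
    let ?ps = "[(a, b1), (a', b2), (a', b1), (a', b), (a', b2), (a', b1), (a, b1), (a, b2), (a', b2)]"
    have "legal_path A B E F ?ps \<sigma>"
      by (simp add: transpose_def mem E F' F0 F0[THEN symF] neq)
    moreover have "foldl (\<lambda>\<tau> (a, b). \<tau> \<circ> transpose a b) \<sigma> ?ps = \<sigma> \<circ> transpose a b"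
      (is "?l = ?r")
    proof
      show "?l x = ?r x" for x using cases[of x] by (elim disjE) (simp_all add: transpose_def neq)
    qed
    ultimately show ?thesis using swap_reach_path by metis
  next
    assume E0: "E a b"
    \<comment> \<open>The edge \<open>a\<close>, \<open>b\<close> is used, but the people initially
      at \<open>a\<close> and \<open>b\<close> never trade places with each other, so
      \<open>F (\<sigma> a) (\<sigma> b)\<close> may fail.\<close>
    let ?ps = "[(a, b1), (a', b2), (a, b2), (a, b), (a', b), (a', b2), (a', b1), (a', b), (a', b2)]"
    have "legal_path A B E F ?ps \<sigma>"
      by (simp add: transpose_def mem E F' E0 neq)
    moreover have "foldl (\<lambda>\<tau> (a, b). \<tau> \<circ> transpose a b) \<sigma> ?ps = \<sigma> \<circ> transpose a b"
      (is "?l = ?r")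
    proof
      show "?l x = ?r x" for x using cases[of x] by (elim disjE) (simp_all add: transpose_def neq)
    qed
    ultimately show ?thesis using swap_reach_path by metis
  qed
qed

lemma card_Collect_remove:
  assumes "finite S" "n \<le> card {x \<in> S. P x}"
  shows "n - 1 \<le> card {x \<in> S - {z}. P x}"
proof -
  have "{x \<in> S - {z}. P x} = {x \<in> S. P x} - {z}" by auto
  then show ?thesis
    using assms diff_card_le_card_Diff[of "{z}" "{x \<in> S. P x}"] by simp
qed

context bipartite_degrees
begin

lemma swap_reach_symF: "swap_reach S T G F \<sigma> \<tau> \<Longrightarrow> swap_reach S T G F \<tau> \<sigma>"
  using swap_reach_sym symF by blast

lemma deg_le:
  assumes "r > 0" shows "d \<le> r" "e \<le> r"
proof -
  obtain a p where "a \<in> A" "p \<in> C" using assms card by (metis card.empty ex_in_conv less_irrefl)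
  then show "d \<le> r" "e \<le> r"
    using EA[of a] FC[of p] card card_Collect_le[OF fin(2), of "E a"] card_Collect_le[OF fin(4), of "F p"]
    by simp_all
qed

lemma bipartite_degrees_remove:
  assumes "a \<in> A" "b \<in> B" "p \<in> C" "q \<in> D"
  shows "bipartite_degrees (A - {a}) (B - {b}) (C - {p}) (D - {q}) E F (r - 1) (d - 1) (e - 1)"
proof unfold_locales
  show "d - 1 \<le> card {y \<in> B - {b}. E x y}" if "x \<in> A - {a}" for x
    using that fin by (intro card_Collect_remove EA) auto
  show "d - 1 \<le> card {x \<in> A - {a}. E x y}" if "y \<in> B - {b}" for y
    using that fin by (intro card_Collect_remove EB) auto
  show "e - 1 \<le> card {y \<in> D - {q}. F x y}" if "x \<in> C - {p}" for x
    using that fin by (intro card_Collect_remove FC) auto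
  show "e - 1 \<le> card {x \<in> C - {p}. F y x}" if "y \<in> D - {q}" for y
    using that fin by (intro card_Collect_remove FD) auto
qed (use assms fin disj card symF in auto)

text \<open>In a sorted bijection the degree bounds of \<open>Y\<close> hold on whole sides of
  positions, which leaves room for the auxiliary positions of
  \<open>swap_reach_local_exchange\<close>.\<close>

lemma swap_reach_exchange_sorted:
  assumes deg: "3 * r + 2 \<le> 2 * (d + e)" and bij: "bij_betw \<sigma> (A \<union> B) (C \<union> D)"
    and sorted: "\<sigma> ` A = C" "\<sigma> ` B = D"
    and ab: "a \<in> A" "b \<in> B" and EF: "E a b \<or> F (\<sigma> a) (\<sigma> b)"
  shows "swap_reach A B E F \<sigma> (\<sigma> \<circ> transpose a b)"
proof (cases "E a b \<and> F (\<sigma> a) (\<sigma> b)")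
  case True
  then show ?thesis using ab by (blast intro: swap_reach_single)
next
  case False
  have "inj_on \<sigma> A" "inj_on \<sigma> B"
    using bij by (auto simp: bij_betw_def intro: inj_on_subset)
  note pull = card_Collect_pullback[OF this(1) sorted(1)] card_Collect_pullback[OF this(2) sorted(2)]
  have HA: "e \<le> card {y \<in> B. F (\<sigma> x) (\<sigma> y)}" if "x \<in> A" for x
    unfolding pull using FC sorted that by blast
  have HB: "e \<le> card {x \<in> A. F (\<sigma> y) (\<sigma> x)}" if "y \<in> B" for y
    unfolding pull using FD sorted that by blast
  have "card {x \<in> A. E x b} + card {x \<in> A. F (\<sigma> b) (\<sigma> x)}
      \<le> card A + card ({x \<in> A. E x b} \<inter> {x \<in> A. F (\<sigma> b) (\<sigma> x)})"
    using fin by (intro card_Int_bound) auto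
  then have "card ({x \<in> A. E x b} \<inter> {x \<in> A. F (\<sigma> b) (\<sigma> x)}) > 0"
    using deg EB[OF ab(2)] HB[OF ab(2)] card by simp
  then obtain a' where a': "a' \<in> A" "E a' b" "F (\<sigma> b) (\<sigma> a')"
    unfolding card_gt_0_iff by blast
  let ?G = "{y \<in> B. E a y \<and> E a' y \<and> F (\<sigma> a) (\<sigma> y) \<and> F (\<sigma> a') (\<sigma> y)}"
  have "d + d + e + e \<le> 3 * card B + card ?G"
    using card_Collect4_bound[OF fin(2), of "E a" "E a'" "\<lambda>y. F (\<sigma> a) (\<sigma> y)" "\<lambda>y. F (\<sigma> a') (\<sigma> y)"]
      EA[OF ab(1)] EA[OF a'(1)] HA[OF ab(1)] HA[OF a'(1)] by simp
  \<comment> \<open>The slack 2 in \<open>deg\<close> is what provides the two positions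
    \<open>b1\<close> and \<open>b2\<close>.\<close>
  then have "2 \<le> card ?G" using deg card by simp
  then obtain G where "G \<subseteq> ?G" "card G = 2" by (meson obtain_subset_with_card_n)
  then obtain b1 b2 where "b1 \<in> ?G" "b2 \<in> ?G" "b1 \<noteq> b2" unfolding card_2_iff by blast
  \<comment> \<open>If \<open>b\<close> lay in \<open>?G\<close>, or if \<open>a' = a\<close>, then
    both edges at \<open>a\<close>, \<open>b\<close> would be present, which \<open>False\<close>
    excludes.\<close>
  moreover from this have "b1 \<noteq> b" "b2 \<noteq> b" using False by auto
  moreover have "a \<noteq> a'" using a' False symF by blast
  ultimately show ?thesis
    using a' ab disj symF EF by (intro swap_reach_local_exchange[of a A a' b B b1 b2]) auto
qed

lemma swap_reach_exchange_CD:
  assumes deg: "3 * r + 2 \<le> 2 * (d + e)" and bij: "bij_betw \<sigma> (A \<union> B) (C \<union> D)"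
    and ab: "a \<in> A" "b \<in> B" "\<sigma> a \<in> C" "\<sigma> b \<in> D" and EF: "E a b \<or> F (\<sigma> a) (\<sigma> b)"
  shows "swap_reach A B E F \<sigma> (\<sigma> \<circ> transpose a b)"
proof -
  let ?A = "A - {a}" and ?B = "B - {b}" and ?C = "C - {\<sigma> a}" and ?D = "D - {\<sigma> b}"
  interpret rest: bipartite_degrees ?A ?B ?C ?D E F "r - 1" "d - 1" "e - 1"
    using ab by (rule bipartite_degrees_remove)
  have rpos: "r > 0" using ab fin card by (metis card_gt_0_iff empty_iff)
  have "bij_betw \<sigma> (A \<union> B - {a, b}) (C \<union> D - {\<sigma> a, \<sigma> b})"
    using bij ab bij_betw_DiffI[OF bij, of "{a, b}" "{\<sigma> a, \<sigma> b}"]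
    by (auto simp: bij_betw_def inj_on_def)
  moreover have "A \<union> B - {a, b} = ?A \<union> ?B" "C \<union> D - {\<sigma> a, \<sigma> b} = ?C \<union> ?D"
    using ab disj by auto
  ultimately have "bij_betw \<sigma> (?A \<union> ?B) (?C \<union> ?D)" by simp
  \<comment> \<open>Removal lowers the left side by 4 (3 from \<open>r\<close>, 1 from the weaker
    bound) and the right side by 4. By \<open>deg_le\<close> and \<open>deg\<close> both degrees are
    positive, so no subtraction truncates.\<close>
  moreover have "3 * (r - 1) + 1 \<le> 2 * ((d - 1) + (e - 1))"
    using deg deg_le[OF rpos] rpos by simp
  ultimately obtain \<tau> where \<tau>: "swap_reach ?A ?B E F \<sigma> \<tau>" "\<tau> ` ?A = ?C" "\<tau> ` ?B = ?D"
    using rest.swap_reach_sorted by blast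
  have out: "a \<notin> ?A \<union> ?B" "b \<notin> ?A \<union> ?B" using ab disj by auto
  have \<tau>ab: "\<tau> a = \<sigma> a" "\<tau> b = \<sigma> b" using out by (auto intro: swap_reach_outside[OF \<tau>(1)])
  have reach: "swap_reach A B E F \<sigma> \<tau>" by (rule swap_reach_mono[OF _ _ \<tau>(1)]) auto
  have reach': "swap_reach A B E F (\<tau> \<circ> transpose a b) (\<sigma> \<circ> transpose a b)"
    by (rule swap_reach_symF, rule swap_reach_mono[OF _ _ swap_reach_comp_transpose[OF \<tau>(1) out]]) auto
  have "\<tau> ` A = C" "\<tau> ` B = D"
    using \<tau>(2,3) \<tau>ab ab by (metis image_insert insert_Diff)+
  then have "swap_reach A B E F \<tau> (\<tau> \<circ> transpose a b)"
    using swap_reach_exchange_sorted[OF deg swap_reach_bij_betw[OF reach bij]] ab EF \<tau>ab by simp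
  then show ?thesis using reach reach' by (meson rtranclp_trans)
qed

text \<open>The exchange is an involution, so the case with \<open>D\<close> on \<open>a\<close> is
  the \<open>C\<close> case started from the other end.\<close>

lemma swap_reach_exchange:
  assumes deg: "3 * r + 2 \<le> 2 * (d + e)" and bij: "bij_betw \<sigma> (A \<union> B) (C \<union> D)"
    and ab: "a \<in> A" "b \<in> B" "\<sigma> a \<in> C \<and> \<sigma> b \<in> D \<or> \<sigma> a \<in> D \<and> \<sigma> b \<in> C"
    and EF: "E a b \<or> F (\<sigma> a) (\<sigma> b)"
  shows "swap_reach A B E F \<sigma> (\<sigma> \<circ> transpose a b)"
  using ab(3)
proof
  assume "\<sigma> a \<in> C \<and> \<sigma> b \<in> D"
  then show ?thesis using swap_reach_exchange_CD[OF deg bij] ab EF by blast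
next
  assume h: "\<sigma> a \<in> D \<and> \<sigma> b \<in> C"
  let ?\<tau> = "\<sigma> \<circ> transpose a b"
  have "bij_betw ?\<tau> (A \<union> B) (C \<union> D)" using bij ab by (intro bij_betw_comp_transpose) auto
  moreover have "E a b \<or> F (?\<tau> a) (?\<tau> b)" using EF symF by auto
  ultimately have "swap_reach A B E F ?\<tau> (?\<tau> \<circ> transpose a b)"
    using deg ab(1,2) h by (intro swap_reach_exchange_CD) auto
  then have "swap_reach A B E F ?\<tau> \<sigma>" by (simp add: comp_assoc)
  then show ?thesis by (rule swap_reach_symF)
qed

end

section \<open>The two classes\<close>

text \<open>Adjacency in the complete bipartite graph with sides \<open>C\<close> and
  \<open>D\<close>.\<close>

definition opposite :: "'b set \<Rightarrow> 'b set \<Rightarrow> 'b \<Rightarrow> 'b \<Rightarrow> bool" where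
  "opposite C D p q \<longleftrightarrow> p \<in> C \<and> q \<in> D \<or> p \<in> D \<and> q \<in> C"

lemma swap_reach_simulate:
  assumes "swap_reach A B E F \<sigma> \<tau>" "bij_betw \<sigma> (A \<union> B) T"
    and sim: "\<And>\<rho> a b. bij_betw \<rho> (A \<union> B) T \<Longrightarrow> a \<in> A \<Longrightarrow> b \<in> B \<Longrightarrow> E a b \<Longrightarrow> F (\<rho> a) (\<rho> b) \<Longrightarrow>
      swap_reach A B E' F' \<rho> (\<rho> \<circ> transpose a b)"
  shows "swap_reach A B E' F' \<sigma> \<tau>"
  using assms(1)
proof (induction rule: rtranclp_induct)
  case (step \<rho> \<tau>)
  then obtain a b where "a \<in> A" "b \<in> B" "E a b" "F (\<rho> a) (\<rho> b)" "\<tau> = \<rho> \<circ> transpose a b"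
    by (auto simp: swap_step_def)
  moreover have "bij_betw \<rho> (A \<union> B) T"
    using swap_reach_bij_betw[OF step.hyps(1) assms(2)] by simp
  ultimately have "swap_reach A B E' F' \<rho> \<tau>" using sim by blast
  with step.IH show ?case by (rule rtranclp_trans)
qed simp

text \<open>\<open>deg\<close> is twice the bound of the theorem, to stay in the naturals.
  Bipartiteness of \<open>Y\<close> is \<open>F_opposite\<close>; that of \<open>X\<close> is built
  into \<open>swap_step\<close>.\<close>

locale bipartite_swapping = bipartite_degrees +
  assumes deg: "3 * r + 2 \<le> 2 * (d + e)"
    and F_opposite: "\<And>p q. F p q \<Longrightarrow> opposite C D p q"
    and r: "2 \<le> r"
begin

text \<open>
  The exchange lemma tolerates one missing edge, either in \<open>X\<close> or in \<open>Y\<close>. It is used twice: first to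
  replace \<open>X\<close> by the complete bipartite graph, then to replace \<open>Y\<close>.
\<close>

lemma swap_reach_complete:
  assumes "swap_reach A B (\<lambda>_ _. True) (opposite C D) \<sigma> \<tau>" "bij_betw \<sigma> (A \<union> B) (C \<union> D)"
  shows "swap_reach A B E F \<sigma> \<tau>"
proof (rule swap_reach_simulate[OF _ assms(2)])
  have dr: "d \<le> r" using deg_le r by simp
  \<comment> \<open>A complete \<open>X\<close> has all degrees \<open>r\<close>, and
    \<open>d \<le> r\<close> keeps the required bound.\<close>
  interpret full: bipartite_degrees A B C D "\<lambda>_ _. True" F r r e
    using fin disj card symF FC FD by unfold_locales auto
  show "swap_reach A B (\<lambda>_ _. True) F \<sigma> \<tau>"
  proof (rule swap_reach_simulate[OF assms])
    show "swap_reach A B (\<lambda>_ _. True) F \<rho> (\<rho> \<circ> transpose a b)"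
      if "bij_betw \<rho> (A \<union> B) (C \<union> D)" "a \<in> A" "b \<in> B" "opposite C D (\<rho> a) (\<rho> b)" for \<rho> a b
      using that deg dr by (intro full.swap_reach_exchange) (auto simp: opposite_def)
  qed
  show "swap_reach A B E F \<rho> (\<rho> \<circ> transpose a b)"
    if "bij_betw \<rho> (A \<union> B) (C \<union> D)" "a \<in> A" "b \<in> B" "F (\<rho> a) (\<rho> b)" for \<rho> a b
    using that F_opposite[of "\<rho> a" "\<rho> b"]
    by (intro swap_reach_exchange[OF deg]) (auto simp: opposite_def)
qed

section \<open>Sorted bijections up to swaps\<close>

definition sorted_bij where
  "sorted_bij \<sigma> \<longleftrightarrow> bij_betw \<sigma> (A \<union> B) (C \<union> D) \<and> \<sigma> ` A = C \<and> \<sigma> ` B = D"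

lemma sorted_bij_comp_transpose:
  assumes "sorted_bij \<sigma>" "x \<in> A \<and> y \<in> A \<or> x \<in> B \<and> y \<in> B"
  shows "sorted_bij (\<sigma> \<circ> transpose x y)"
proof -
  have "x \<in> A \<longleftrightarrow> y \<in> A" "x \<in> B \<longleftrightarrow> y \<in> B" using assms(2) disj by auto
  then have "transpose x y ` A = A" "transpose x y ` B = B"
    by (simp_all add: transpose_image_eq)
  then have "(\<sigma> \<circ> transpose x y) ` A = C" "(\<sigma> \<circ> transpose x y) ` B = D"
    using assms(1) by (simp_all only: sorted_bij_def image_comp[symmetric])
  then show ?thesis
    using assms by (auto simp: sorted_bij_def intro!: bij_betw_comp_transpose)
qed

lemma swap_reach_double_transpose:
  assumes "sorted_bij \<sigma>" "a1 \<in> A" "a2 \<in> A" "b1 \<in> B" "b2 \<in> B" "a1 \<noteq> a2" "b1 \<noteq> b2"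
  shows "swap_reach A B E F \<sigma> (\<sigma> \<circ> transpose a1 a2 \<circ> transpose b1 b2)"
proof (rule swap_reach_complete)
  show "bij_betw \<sigma> (A \<union> B) (C \<union> D)" using assms(1) by (simp add: sorted_bij_def)
  have ne: "a1 \<noteq> a2" "b1 \<noteq> b2" "a1 \<noteq> b1" "a1 \<noteq> b2" "a2 \<noteq> b1" "a2 \<noteq> b2"
    using assms disj by auto
  have mem: "\<sigma> a1 \<in> C" "\<sigma> a2 \<in> C" "\<sigma> b1 \<in> D" "\<sigma> b2 \<in> D"
    using assms by (auto simp: sorted_bij_def)
  let ?ps = "[(a1, b1), (a2, b2), (a1, b2), (a2, b1)]"
  have "legal_path A B (\<lambda>_ _. True) (opposite C D) ?ps \<sigma>"
    using assms(2-5) ne ne[symmetric] mem by (simp add: opposite_def transpose_def)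
  moreover have "foldl (\<lambda>\<tau> (a, b). \<tau> \<circ> transpose a b) \<sigma> ?ps = \<sigma> \<circ> transpose a1 a2 \<circ> transpose b1 b2"
    (is "?l = ?r")
  proof
    fix x
    have "x = a1 \<or> x = a2 \<or> x = b1 \<or> x = b2 \<or> (x \<noteq> a1 \<and> x \<noteq> a2 \<and> x \<noteq> b1 \<and> x \<noteq> b2)" by blast
    then show "?l x = ?r x" by (elim disjE) (simp_all add: transpose_def ne ne[symmetric])
  qed
  ultimately show "swap_reach A B (\<lambda>_ _. True) (opposite C D) \<sigma> (\<sigma> \<circ> transpose a1 a2 \<circ> transpose b1 b2)"
    using swap_reach_path by metis
qed

text \<open>All transpositions within a side are interchangeable. One in \<open>A\<close> is traded
  for one in \<open>B\<close> by a double transposition; two in \<open>B\<close> are compared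
  through an auxiliary pair in \<open>A\<close>.\<close>

lemma swap_reach_transpose_transpose:
  assumes \<sigma>: "sorted_bij \<sigma>" and b: "b1 \<in> B" "b2 \<in> B" "b1 \<noteq> b2"
    and xy: "x \<in> A \<and> y \<in> A \<or> x \<in> B \<and> y \<in> B" "x \<noteq> y"
  shows "swap_reach A B E F (\<sigma> \<circ> transpose x y) (\<sigma> \<circ> transpose b1 b2)"
proof -
  have A: "swap_reach A B E F (\<sigma> \<circ> transpose x y) (\<sigma> \<circ> transpose b1 b2)"
    if "x \<in> A" "y \<in> A" "x \<noteq> y" for x y
    using swap_reach_double_transpose[OF sorted_bij_comp_transpose[OF \<sigma>, of x y] that(1,2) b(1,2) that(3) b(3)] that
    by (simp add: comp_assoc)
  show ?thesis
  proof (cases "x \<in> A \<and> y \<in> A")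
    case True
    then show ?thesis using A xy by blast
  next
    case False
    then have B: "x \<in> B" "y \<in> B" using xy by auto
    have "2 \<le> card A" using card r by simp
    then obtain S where "S \<subseteq> A" "card S = 2" by (meson obtain_subset_with_card_n)
    then obtain a1 a2 where a: "a1 \<in> A" "a2 \<in> A" "a1 \<noteq> a2" unfolding card_2_iff by blast
    have ne: "a1 \<noteq> x" "a1 \<noteq> y" "a2 \<noteq> x" "a2 \<noteq> y" using a B disj by auto
    have "swap_reach A B E F (\<sigma> \<circ> transpose x y)
        (\<sigma> \<circ> transpose x y \<circ> transpose a1 a2 \<circ> transpose x y)"
      using a B xy(2) by (intro swap_reach_double_transpose sorted_bij_comp_transpose \<sigma>) auto
    moreover have "\<sigma> \<circ> transpose x y \<circ> transpose a1 a2 \<circ> transpose x y = \<sigma> \<circ> transpose a1 a2"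
      using ne by (auto simp: fun_eq_iff transpose_def)
    ultimately show ?thesis using A[OF a] by simp
  qed
qed

text \<open>Correct disagreements with \<open>\<tau>\<close> by transpositions within a side. Each
  toggles between the two classes, and a second toggle cancels the first.\<close>

lemma sorted_bij_two_classes:
  assumes b: "b1 \<in> B" "b2 \<in> B" "b1 \<noteq> b2" and \<tau>: "sorted_bij \<tau>"
    and "sorted_bij \<sigma>" and "\<And>x. x \<notin> A \<union> B \<Longrightarrow> \<sigma> x = \<tau> x"
  shows "swap_reach A B E F \<sigma> \<tau> \<or> swap_reach A B E F (\<sigma> \<circ> transpose b1 b2) \<tau>"
  using assms(5,6)
proof (induction "card {x \<in> A \<union> B. \<sigma> x \<noteq> \<tau> x}" arbitrary: \<sigma> rule: less_induct)
  case less
  let ?N = "{x \<in> A \<union> B. \<sigma> x \<noteq> \<tau> x}"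
  show ?case
  proof (cases "?N = {}")
    case True
    then have "\<sigma> = \<tau>" using less.prems(2) by blast
    then show ?thesis by simp
  next
    case False
    then obtain x where x: "x \<in> A \<union> B" "\<sigma> x \<noteq> \<tau> x" by blast
    \<comment> \<open>Both bijections are sorted, so the person wanted at \<open>x\<close> already
      stands on the same side.\<close>
    obtain y where y: "x \<in> A \<and> y \<in> A \<or> x \<in> B \<and> y \<in> B" "\<sigma> y = \<tau> x"
    proof -
      have "\<sigma> ` A = \<tau> ` A" "\<sigma> ` B = \<tau> ` B" using less.prems(1) \<tau> by (simp_all add: sorted_bij_def)
      then have "x \<in> A \<Longrightarrow> \<tau> x \<in> \<sigma> ` A" "x \<in> B \<Longrightarrow> \<tau> x \<in> \<sigma> ` B" by blast+
      then show thesis using x(1) that by (metis UnE imageE)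
    qed
    have ne: "x \<noteq> y" using x y by auto
    have inj: "inj_on \<tau> (A \<union> B)" using \<tau> by (simp add: sorted_bij_def bij_betw_def)
    let ?\<sigma> = "\<sigma> \<circ> transpose x y"
    have s: "sorted_bij ?\<sigma>" using sorted_bij_comp_transpose[OF less.prems(1) y(1)] .
    \<comment> \<open>Since \<open>y\<close> is wrong as well, transposing \<open>x\<close> and
      \<open>y\<close> settles \<open>x\<close> and spoils nothing.\<close>
    have "\<sigma> y \<noteq> \<tau> y" using y inj ne x by (auto simp: inj_on_def)
    then have "{z \<in> A \<union> B. ?\<sigma> z \<noteq> \<tau> z} \<subseteq> ?N - {x}"
      using y x ne by (auto simp: transpose_def split: if_splits)
    then have "card {z \<in> A \<union> B. ?\<sigma> z \<noteq> \<tau> z} < card ?N"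
      using x fin by (intro psubset_card_mono) auto
    moreover have "?\<sigma> z = \<tau> z" if "z \<notin> A \<union> B" for z
      using less.prems(2)[OF that] that y(1) by (auto simp: transpose_def)
    ultimately have "swap_reach A B E F ?\<sigma> \<tau> \<or> swap_reach A B E F (?\<sigma> \<circ> transpose b1 b2) \<tau>"
      using less.hyps s by blast
    then show ?thesis
    proof
      assume "swap_reach A B E F ?\<sigma> \<tau>"
      moreover have "swap_reach A B E F (\<sigma> \<circ> transpose b1 b2) ?\<sigma>"
        using swap_reach_transpose_transpose[OF less.prems(1) b y(1) ne] by (rule swap_reach_symF)
      ultimately show ?thesis by (meson rtranclp_trans)
    next
      assume "swap_reach A B E F (?\<sigma> \<circ> transpose b1 b2) \<tau>"
      moreover have "swap_reach A B E F \<sigma> (?\<sigma> \<circ> transpose b1 b2)"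
        using swap_reach_transpose_transpose[OF s b y(1) ne] by (simp add: comp_assoc)
      ultimately show ?thesis by (meson rtranclp_trans)
    qed
  qed
qed

lemma swap_reach_two_classes:
  assumes b: "b1 \<in> B" "b2 \<in> B" "b1 \<noteq> b2" and \<rho>: "sorted_bij \<rho>"
    and \<sigma>: "bij_betw \<sigma> (A \<union> B) (C \<union> D)" "\<And>x. x \<notin> A \<union> B \<Longrightarrow> \<sigma> x = \<rho> x"
  shows "swap_reach A B E F \<rho> \<sigma> \<or> swap_reach A B E F (\<rho> \<circ> transpose b1 b2) \<sigma>"
proof -
  have "3 * r + 1 \<le> 2 * (d + e)" using deg by simp
  from swap_reach_sorted[OF this \<sigma>(1)] obtain \<tau>
    where \<tau>: "swap_reach A B E F \<sigma> \<tau>" "\<tau> ` A = C" "\<tau> ` B = D" by blast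
  have "sorted_bij \<tau>"
    using \<tau> swap_reach_bij_betw[OF \<tau>(1) \<sigma>(1)] by (simp add: sorted_bij_def)
  moreover have "\<rho> x = \<tau> x" if "x \<notin> A \<union> B" for x
    using swap_reach_outside[OF \<tau>(1) that] \<sigma>(2)[OF that] by simp
  ultimately have "swap_reach A B E F \<rho> \<tau> \<or> swap_reach A B E F (\<rho> \<circ> transpose b1 b2) \<tau>"
    using sorted_bij_two_classes[OF b _ \<rho>] by blast
  moreover have "swap_reach A B E F \<tau> \<sigma>" using \<tau>(1) by (rule swap_reach_symF)
  ultimately show ?thesis by (meson rtranclp_trans)
qed

section \<open>The parity invariant\<close>

text \<open>A bijection between different sets has no sign by itself; composing with the inverse of
  a reference \<open>\<rho>\<close>, and extending by the identity, gives a permutation that has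
  one.\<close>

definition relative_perm where
  "relative_perm \<rho> \<sigma> x = (if x \<in> A \<union> B then inv_into (A \<union> B) \<rho> (\<sigma> x) else x)"

lemma relative_perm_permutes:
  assumes "bij_betw \<rho> (A \<union> B) (C \<union> D)" "bij_betw \<sigma> (A \<union> B) (C \<union> D)"
  shows "relative_perm \<rho> \<sigma> permutes (A \<union> B)"
proof (rule bij_imp_permutes)
  have "bij_betw (inv_into (A \<union> B) \<rho> \<circ> \<sigma>) (A \<union> B) (A \<union> B)"
    using assms(2) bij_betw_inv_into[OF assms(1)] by (rule bij_betw_trans)
  then show "bij_betw (relative_perm \<rho> \<sigma>) (A \<union> B) (A \<union> B)"
    by (rule bij_betw_cong[THEN iffD1, rotated]) (simp add: relative_perm_def)
qed (simp add: relative_perm_def)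

lemma evenperm_relative_perm_comp_transpose:
  assumes "bij_betw \<rho> (A \<union> B) (C \<union> D)" "bij_betw \<sigma> (A \<union> B) (C \<union> D)"
    and "x \<in> A \<union> B" "y \<in> A \<union> B" "x \<noteq> y"
  shows "evenperm (relative_perm \<rho> (\<sigma> \<circ> transpose x y)) \<longleftrightarrow> \<not> evenperm (relative_perm \<rho> \<sigma>)"
proof -
  have "relative_perm \<rho> (\<sigma> \<circ> transpose x y) = relative_perm \<rho> \<sigma> \<circ> transpose x y"
    using assms(3,4) by (auto simp: fun_eq_iff relative_perm_def transpose_def)
  moreover have "permutation (relative_perm \<rho> \<sigma>)"
    using relative_perm_permutes[OF assms(1,2)] fin by (auto intro: permutes_imp_permutation)
  ultimately show ?thesis
    using assms(5) by (simp add: evenperm_comp permutation_swap_id evenperm_swap)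
qed

definition parity where
  "parity \<rho> \<sigma> \<longleftrightarrow> (evenperm (relative_perm \<rho> \<sigma>) \<longleftrightarrow> even (card {a \<in> A. \<sigma> a \<in> C}))"

text \<open>A swap multiplies by one transposition and changes the number of \<open>C\<close>-people
  on \<open>A\<close> by one, so both sides of the equivalence flip.\<close>

lemma parity_swap_reach:
  assumes \<rho>: "bij_betw \<rho> (A \<union> B) (C \<union> D)" and \<sigma>: "bij_betw \<sigma> (A \<union> B) (C \<union> D)"
    and "swap_reach A B E F \<sigma> \<tau>"
  shows "parity \<rho> \<tau> = parity \<rho> \<sigma>"
  using assms(3)
proof (induction rule: rtranclp_induct)
  case (step \<pi> \<tau>)
  then obtain a b where ab: "a \<in> A" "b \<in> B" "F (\<pi> a) (\<pi> b)" "\<tau> = \<pi> \<circ> transpose a b"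
    by (auto simp: swap_step_def)
  have ne: "a \<noteq> b" using ab disj by auto
  have bij: "bij_betw \<pi> (A \<union> B) (C \<union> D)"
    using swap_reach_bij_betw[OF step.hyps(1) \<sigma>] by simp
  have \<tau>: "\<tau> x = (if x = a then \<pi> b else \<pi> x)" if "x \<in> A" for x
    using that ab disj by (auto simp: transpose_def)
  let ?S = "{x \<in> A - {a}. \<pi> x \<in> C}"
  have S: "{x \<in> A. \<pi> x \<in> C} = (if \<pi> a \<in> C then insert a ?S else ?S)"
    "{x \<in> A. \<tau> x \<in> C} = (if \<pi> b \<in> C then insert a ?S else ?S)"
    using ab(1) \<tau> by (auto split: if_splits)
  have "\<pi> a \<in> C \<longleftrightarrow> \<pi> b \<notin> C" using F_opposite[OF ab(3)] disj by (auto simp: opposite_def)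
  moreover have "card (insert a ?S) = Suc (card ?S)" using fin by simp
  ultimately have "even (card {x \<in> A. \<tau> x \<in> C}) \<longleftrightarrow> \<not> even (card {x \<in> A. \<pi> x \<in> C})"
    unfolding S by auto
  moreover have "evenperm (relative_perm \<rho> \<tau>) \<longleftrightarrow> \<not> evenperm (relative_perm \<rho> \<pi>)"
    using evenperm_relative_perm_comp_transpose[OF \<rho> bij] ab ne by simp
  ultimately show ?case using step.IH by (auto simp: parity_def)
qed simp

text \<open>A transposition within \<open>B\<close> flips the sign but leaves the people on
  \<open>A\<close> alone.\<close>

lemma not_swap_reach_transpose:
  assumes "sorted_bij \<rho>" "b1 \<in> B" "b2 \<in> B" "b1 \<noteq> b2"
  shows "\<not> swap_reach A B E F \<rho> (\<rho> \<circ> transpose b1 b2)"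
proof
  have bij: "bij_betw \<rho> (A \<union> B) (C \<union> D)" using assms by (simp add: sorted_bij_def)
  assume "swap_reach A B E F \<rho> (\<rho> \<circ> transpose b1 b2)"
  then have "parity \<rho> (\<rho> \<circ> transpose b1 b2) = parity \<rho> \<rho>" using parity_swap_reach[OF bij bij] by blast
  moreover have "{a \<in> A. (\<rho> \<circ> transpose b1 b2) a \<in> C} = {a \<in> A. \<rho> a \<in> C}"
    using assms disj by (auto simp: transpose_def)
  ultimately show False
    using evenperm_relative_perm_comp_transpose[OF bij bij, of b1 b2] assms(2-4)
    unfolding parity_def by auto
qed

end

section \<open>Friends-and-strangers graphs\<close>

lemma min_degree_le_card_neighbours:
  assumes "pair_graph G" "pverts G = A \<union> B" "A \<inter> B = {}"
    and "parcs G \<subseteq> A \<times> B \<union> B \<times> A" "a \<in> A"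
  shows "min_degree (with_proj G) \<le> card {b \<in> B. (a, b) \<in> parcs G}"
proof -
  interpret pair_graph G by fact
  have "min_degree (with_proj G) \<le> out_degree (with_proj G) a"
    unfolding min_degree_def using assms(2,5) pair_finite_verts by (intro Min_le) auto
  also have "out_arcs (with_proj G) a = Pair a ` {b \<in> B. (a, b) \<in> parcs G}"
    using assms(3,4,5) by (auto simp: out_arcs_def)
  then have "out_degree (with_proj G) a = card {b \<in> B. (a, b) \<in> parcs G}"
    by (simp add: out_degree_def card_image inj_on_def)
  finally show ?thesis .
qed

lemma bipartite_degreesI:
  assumes X: "pair_graph X" "pverts X = A \<union> B" "A \<inter> B = {}" "parcs X \<subseteq> A \<times> B \<union> B \<times> A"
    and Y: "pair_graph Y" "pverts Y = C \<union> D" "C \<inter> D = {}" "parcs Y \<subseteq> C \<times> D \<union> D \<times> C"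
    and card: "card A = r" "card B = r" "card C = r" "card D = r"
  shows "bipartite_degrees A B C D (\<lambda>a b. (a, b) \<in> parcs X) (\<lambda>p q. (p, q) \<in> parcs Y) r
    (min_degree (with_proj X)) (min_degree (with_proj Y))"
proof -
  interpret X: pair_graph X by fact
  interpret Y: pair_graph Y by fact
  have symX: "(u, v) \<in> parcs X \<longleftrightarrow> (v, u) \<in> parcs X" for u v
    using X.arcs_symmetric by blast
  show ?thesis
  proof unfold_locales
    show "min_degree (with_proj X) \<le> card {b \<in> B. (a, b) \<in> parcs X}" if "a \<in> A" for a
      using min_degree_le_card_neighbours[OF X that] .
    show "min_degree (with_proj X) \<le> card {a \<in> A. (a, b) \<in> parcs X}" if "b \<in> B" for b
      using min_degree_le_card_neighbours[of X B A b] X that symX[of _ b] by (simp add: Un_commute Int_commute)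
    show "min_degree (with_proj Y) \<le> card {q \<in> D. (p, q) \<in> parcs Y}" if "p \<in> C" for p
      using min_degree_le_card_neighbours[OF Y that] .
    show "min_degree (with_proj Y) \<le> card {p \<in> C. (q, p) \<in> parcs Y}" if "q \<in> D" for q
      using min_degree_le_card_neighbours[of Y D C q] Y that by (simp add: Un_commute Int_commute)
    show "(q, p) \<in> parcs Y" if "(p, q) \<in> parcs Y" for p q
      using Y.arcs_symmetric that by blast
    show "finite A" "finite B" "finite C" "finite D"
      using X.pair_finite_verts Y.pair_finite_verts X(2) Y(2) by simp_all
  qed fact+
qed

lemma edge_subgraph_bipartition:
  assumes "K\<^bsub>r,r\<^esub> (with_proj K)" "spanning (with_proj G) (with_proj K)"
  obtains U V where "pverts G = U \<union> V" "U \<inter> V = {}" "parcs G \<subseteq> U \<times> V \<union> V \<times> U"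
    "card U = r" "card V = r"
proof -
  obtain U V where "pverts K = U \<union> V" "U \<inter> V = {}" "card U = r" "card V = r"
    "parcs K = U \<times> V \<union> V \<times> U"
    using assms(1) unfolding complete_bipartite_digraph_pair_def by blast
  moreover have "pverts G = pverts K" "parcs G \<subseteq> parcs K"
    using assms(2) by (auto simp: spanning_def subgraph_def)
  ultimately show thesis using that[of U V] by simp
qed

text \<open>Extensionality makes \<open>\<tau>\<close> equal to the composition also outside the
  vertex set; symmetry of both graphs turns an arc from \<open>B\<close> to \<open>A\<close>
  around.\<close>

lemma friends_and_strangers_arcs_iff:
  assumes X: "pair_graph X" "pverts X = A \<union> B" "A \<inter> B = {}" "parcs X \<subseteq> A \<times> B \<union> B \<times> A"
    and Y: "pair_graph Y"
    and V: "\<sigma> \<in> pverts (friends_and_strangers X Y)" "\<tau> \<in> pverts (friends_and_strangers X Y)"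
  shows "(\<sigma>, \<tau>) \<in> parcs (friends_and_strangers X Y) \<longleftrightarrow>
    swap_step A B (\<lambda>a b. (a, b) \<in> parcs X) (\<lambda>p q. (p, q) \<in> parcs Y) \<sigma> \<tau>"
    (is "?l \<longleftrightarrow> ?r")
proof -
  interpret X: pair_graph X by fact
  interpret Y: pair_graph Y by fact
  have ext: "\<sigma> \<in> extensional (pverts X)" "\<tau> \<in> extensional (pverts X)"
    using V by (simp_all add: friends_and_strangers_def)
  have iff: "?l \<longleftrightarrow> (\<exists>a \<in> pverts X. \<exists>b \<in> pverts X. a \<noteq> b \<and>
            (a, b) \<in> parcs X \<and> (\<sigma> a, \<sigma> b) \<in> parcs Y \<and>
            \<tau> a = \<sigma> b \<and> \<tau> b = \<sigma> a \<and> (\<forall>w \<in> pverts X - {a, b}. \<tau> w = \<sigma> w))"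
    using V by (simp add: friends_and_strangers_def Let_def)
  show ?thesis
  proof
    assume ?l
    then obtain a b where ab: "a \<in> pverts X" "b \<in> pverts X" "a \<noteq> b"
      "(a, b) \<in> parcs X" "(\<sigma> a, \<sigma> b) \<in> parcs Y" "\<tau> a = \<sigma> b" "\<tau> b = \<sigma> a"
      "\<forall>w \<in> pverts X - {a, b}. \<tau> w = \<sigma> w"
      unfolding iff by blast
    have "\<tau> x = (\<sigma> \<circ> transpose a b) x" for x
    proof (cases "x \<in> pverts X")
      case True
      then show ?thesis using ab(6-8) by (auto simp: transpose_def)
    next
      case False
      then show ?thesis using ext ab(1,2) by (auto simp: transpose_def extensional_def)
    qed
    then have \<tau>: "\<tau> = \<sigma> \<circ> transpose a b" by blast
    have "a \<in> A \<and> b \<in> B \<or> a \<in> B \<and> b \<in> A" using ab(4) X(4) by blast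
    then show ?r
    proof
      assume "a \<in> A \<and> b \<in> B"
      then show ?r using ab(4,5) \<tau> by (auto intro: swap_stepI)
    next
      assume "a \<in> B \<and> b \<in> A"
      moreover have "(b, a) \<in> parcs X" "(\<sigma> b, \<sigma> a) \<in> parcs Y"
        using ab(4,5) X.arcs_symmetric Y.arcs_symmetric by blast+
      ultimately show ?r using \<tau> by (auto intro!: swap_stepI[of b _ a] simp: transpose_commute)
    qed
  next
    assume ?r
    then obtain a b where "a \<in> A" "b \<in> B" "(a, b) \<in> parcs X" "(\<sigma> a, \<sigma> b) \<in> parcs Y"
      and \<tau>: "\<tau> = \<sigma> \<circ> transpose a b"
      unfolding swap_step_def by blast
    moreover from this have "a \<noteq> b" using X(3) by blast
    ultimately show ?l unfolding iff using X(2)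
      by (intro bexI[of _ a] bexI[of _ b] conjI) (auto simp: transpose_def)
  qed
qed

lemma friends_and_strangers_reachable_iff:
  assumes X: "pair_graph X" "pverts X = A \<union> B" "A \<inter> B = {}" "parcs X \<subseteq> A \<times> B \<union> B \<times> A"
    and Y: "pair_graph Y"
    and \<sigma>: "\<sigma> \<in> pverts (friends_and_strangers X Y)"
  shows "\<sigma> \<rightarrow>\<^sup>*\<^bsub>with_proj (friends_and_strangers X Y)\<^esub> \<tau> \<longleftrightarrow>
    swap_reach A B (\<lambda>a b. (a, b) \<in> parcs X) (\<lambda>p q. (p, q) \<in> parcs Y) \<sigma> \<tau>"
    (is "_ \<longleftrightarrow> ?reach \<sigma> \<tau>")
proof -
  let ?F = "friends_and_strangers X Y"
  interpret F: pair_graph ?F using X(1) Y by (rule pair_graph_friends_and_strangers)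
  note arcs = friends_and_strangers_arcs_iff[OF X Y]
  have "\<sigma> \<rightarrow>\<^sup>*\<^bsub>with_proj ?F\<^esub> \<tau> \<longleftrightarrow> (\<sigma>, \<tau>) \<in> (parcs ?F)\<^sup>*"
    using F.reachable_conv'[of \<sigma> \<tau>] \<sigma> by simp
  also have "\<dots> \<longleftrightarrow> ?reach \<sigma> \<tau>"
  proof
    assume "(\<sigma>, \<tau>) \<in> (parcs ?F)\<^sup>*"
    then show "?reach \<sigma> \<tau>"
    proof (induction rule: rtrancl_induct)
      case (step \<rho> \<tau>)
      then have "swap_step A B (\<lambda>a b. (a, b) \<in> parcs X) (\<lambda>p q. (p, q) \<in> parcs Y) \<rho> \<tau>"
        using arcs F.in_arcsD1 F.in_arcsD2 by blast
      with step.IH show ?case by (meson rtranclp.rtrancl_into_rtrancl)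
    qed simp
  next
    assume "?reach \<sigma> \<tau>"
    \<comment> \<open>\<open>swap_step\<close> is defined on arbitrary functions, so membership in
      the vertex set is carried through the induction.\<close>
    then have "(\<sigma>, \<tau>) \<in> (parcs ?F)\<^sup>* \<and> \<tau> \<in> pverts ?F"
    proof (induction rule: rtranclp_induct)
      case (step \<rho> \<tau>)
      from step.hyps(2) obtain a b where ab: "a \<in> A" "b \<in> B" "\<tau> = \<rho> \<circ> transpose a b"
        unfolding swap_step_def by blast
      have \<rho>: "\<rho> \<in> extensional (pverts X)" "bij_betw \<rho> (pverts X) (pverts Y)"
        using step.IH by (simp_all add: friends_and_strangers_def)
      have "bij_betw \<tau> (pverts X) (pverts Y)"
        unfolding ab(3) using \<rho>(2) ab X(2) by (intro bij_betw_comp_transpose) auto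
      moreover have "\<tau> \<in> extensional (pverts X)"
        using \<rho>(1) ab X(2) by (auto simp: extensional_def transpose_def)
      ultimately have "\<tau> \<in> pverts ?F" by (simp add: friends_and_strangers_def)
      then show ?case using arcs step.hyps(2) step.IH by (meson rtrancl.rtrancl_into_rtrancl)
    qed (use \<sigma> in simp)
    then show "(\<sigma>, \<tau>) \<in> (parcs ?F)\<^sup>*" ..
  qed
  finally show ?thesis .
qed

theorem theorem1p10:
  fixes r :: nat
    and K X :: "'a pair_pre_digraph"
    and L Y :: "'b pair_pre_digraph"
  assumes "r \<ge> 2"
    and "K\<^bsub>r,r\<^esub> (with_proj K)"
    and "K\<^bsub>r,r\<^esub> (with_proj L)"
    and "pair_graph X" and "spanning (with_proj X) (with_proj K)"
    and "pair_graph Y" and "spanning (with_proj Y) (with_proj L)"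
    and "real (min_degree (with_proj X)) + real (min_degree (with_proj Y)) \<ge> 3 * real r / 2 + 1"
  shows "card (connected_components (with_proj (friends_and_strangers X Y))) = 2"
proof -
  obtain A B where AB: "pverts X = A \<union> B" "A \<inter> B = {}" "parcs X \<subseteq> A \<times> B \<union> B \<times> A"
    "card A = r" "card B = r"
    using assms(2,5) by (rule edge_subgraph_bipartition)
  obtain C D where CD: "pverts Y = C \<union> D" "C \<inter> D = {}" "parcs Y \<subseteq> C \<times> D \<union> D \<times> C"
    "card C = r" "card D = r"
    using assms(3,7) by (rule edge_subgraph_bipartition)
  let ?F = "friends_and_strangers X Y"
  let ?E = "\<lambda>a b. (a, b) \<in> parcs X" and ?H = "\<lambda>p q. (p, q) \<in> parcs Y"
  interpret bipartite_swapping A B C D ?E ?H r "min_degree (with_proj X)" "min_degree (with_proj Y)"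
  proof (intro bipartite_swapping.intro bipartite_swapping_axioms.intro)
    show "bipartite_degrees A B C D ?E ?H r (min_degree (with_proj X)) (min_degree (with_proj Y))"
      by (rule bipartite_degreesI) fact+
    have "3 * real r + 2 \<le> 2 * (real (min_degree (with_proj X)) + real (min_degree (with_proj Y)))"
      using assms(8) by simp
    then have "real (3 * r + 2) \<le> real (2 * (min_degree (with_proj X) + min_degree (with_proj Y)))"
      by simp
    then show "3 * r + 2 \<le> 2 * (min_degree (with_proj X) + min_degree (with_proj Y))"
      by (simp only: of_nat_le_iff)
    show "opposite C D p q" if "(p, q) \<in> parcs Y" for p q
      using that CD(3) by (auto simp: opposite_def)
  qed fact
  interpret F: pair_graph ?F using assms(4,6) by (rule pair_graph_friends_and_strangers)
  have V: "\<sigma> \<in> pverts ?F \<longleftrightarrow> \<sigma> \<in> extensional (A \<union> B) \<and> bij_betw \<sigma> (A \<union> B) (C \<union> D)" for \<sigma>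
    by (simp add: friends_and_strangers_def AB CD)
  have reach: "\<sigma> \<rightarrow>\<^sup>*\<^bsub>with_proj ?F\<^esub> \<tau> \<longleftrightarrow> swap_reach A B ?E ?H \<sigma> \<tau>" if "\<sigma> \<in> pverts ?F" for \<sigma> \<tau>
    using friends_and_strangers_reachable_iff[OF assms(4) AB(1-3) assms(6) that] .
  \<comment> \<open>Reachability is symmetric here, so a component is everything reachable from one
    of its vertices.\<close>
  have scc: "\<tau> \<in> F.scc_of \<sigma> \<longleftrightarrow> swap_reach A B ?E ?H \<sigma> \<tau>" if "\<sigma> \<in> pverts ?F" for \<sigma> \<tau>
    using reach[OF that] F.symmetric_reachable' unfolding F.scc_of_def by blast
  obtain f g where "bij_betw f A C" "bij_betw g B D"
    using fin card by (metis finite_same_card_bij)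
  \<comment> \<open>A sorted reference bijection; the value \<open>undefined\<close> makes it
    extensional. It and \<open>?\<rho>\<close> will represent the two components.\<close>
  define \<rho> where "\<rho> = (\<lambda>x. if x \<in> A then f x else if x \<in> B then g x else undefined)"
  have fA: "bij_betw \<rho> A C"
    using \<open>bij_betw f A C\<close> by (rule bij_betw_cong[THEN iffD1, rotated]) (simp add: \<rho>_def)
  have gB: "bij_betw \<rho> B D"
    using \<open>bij_betw g B D\<close> by (rule bij_betw_cong[THEN iffD1, rotated]) (use disj in \<open>auto simp: \<rho>_def\<close>)
  have sorted: "sorted_bij \<rho>"
    using fA gB bij_betw_combine[OF fA gB] disj by (auto simp: sorted_bij_def bij_betw_def)
  have ext: "\<rho> \<in> extensional (A \<union> B)" by (simp add: \<rho>_def extensional_def)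
  have "2 \<le> card B" using card r by simp
  then obtain S where "S \<subseteq> B" "card S = 2" by (meson obtain_subset_with_card_n)
  then obtain b1 b2 where b: "b1 \<in> B" "b2 \<in> B" "b1 \<noteq> b2" unfolding card_2_iff by blast
  let ?\<rho> = "\<rho> \<circ> transpose b1 b2"
  have \<rho>V: "\<rho> \<in> pverts ?F" using sorted ext by (simp add: V sorted_bij_def)
  have "sorted_bij ?\<rho>" using sorted_bij_comp_transpose[OF sorted] b by blast
  moreover have "?\<rho> \<in> extensional (A \<union> B)" using ext b by (auto simp: extensional_def transpose_def)
  ultimately have \<rho>V': "?\<rho> \<in> pverts ?F" by (simp add: V sorted_bij_def)
  have "F.scc_of \<sigma> = F.scc_of \<rho> \<or> F.scc_of \<sigma> = F.scc_of ?\<rho>" if "\<sigma> \<in> pverts ?F" for \<sigma>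
  proof -
    have "\<sigma> x = \<rho> x" if "x \<notin> A \<union> B" for x
      using that ext \<open>\<sigma> \<in> pverts ?F\<close> by (auto simp: V extensional_def)
    then have "swap_reach A B ?E ?H \<rho> \<sigma> \<or> swap_reach A B ?E ?H ?\<rho> \<sigma>"
      using swap_reach_two_classes[OF b sorted] that by (simp add: V)
    then show ?thesis using scc[OF \<rho>V] scc[OF \<rho>V'] F.scc_of_eq by blast
  qed
  then have "F.scc_of ` pverts ?F = {F.scc_of \<rho>, F.scc_of ?\<rho>}" using \<rho>V \<rho>V' by blast
  moreover have "?\<rho> \<in> F.scc_of ?\<rho>" using scc[OF \<rho>V'] by simp
  then have "F.scc_of \<rho> \<noteq> F.scc_of ?\<rho>"
    using scc[OF \<rho>V] not_swap_reach_transpose[OF sorted b] by blast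
  ultimately have "card F.sccs_verts = 2" by (simp add: F.sccs_verts_conv_scc_of)
  then show ?thesis by (simp add: F.card_sccs_verts)
qed

end
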